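(* For any group $G$, every element of $\widetilde R(G)$ is an unbounded quasi-nil element of $G$.
   Context: Words: $e_1(x,y)=[x,y]$ and $e_n(x,y)=[e_{n-1}(x,y),y]$ for $n\ge 2$, where $[x,y]$ denotes the group commutator (with one fixed standard convention, say $[x,y]=x^{-1}y^{-1}xy$). For positive integers $n_1,\dots,n_k$ define words $\varepsilon_{(n_1,\dots,n_k)}(x_1,\dots,x_k;y)$ inductively by $\varepsilon_{(n_1)}(x_1;y)=e_{n_1}(x_1,y)$ and $\varepsilon_{(n_1,\dots,n_k)}(x_1,\dots,x_k;y)=e_{n_k}\bigl(x_k,\varepsilon_{(n_1,\dots,n_{k-1})}(x_1,\dots,x_{k-1};y)\bigr)$. Unbounded quasi-nil elements: an element $g\in G$ is unbounded quasi-nil if for every infinite sequence $\bar a=(a_1,a_2,\dots)$ of elements of $G$ there are $k=k(\bar a,g)\ge 1$ and a compatible sequence $(n_1,\dots,n_k)$ of positive integers with $\varepsilon_{(n_1,\dots,n_k)}(a_1,\dots,a_k;g)=1$. Compatible means that each $n_i$ depends only on $a_1,\dots,a_i$ and $g$ and not on the later terms of the sequence; that is, there are functions $N_i:G^i\to\mathbb{Z}_{\ge1}$, $i=1,2,\dots$ (depending on $g$), such that for every $\bar a$ there is $k$ for which the equality holds with $n_i=N_i(a_1,\dots,a_i)$, $i=1,\dots,k$. Radical: $R(G)=\mathrm{HP}(G)$ is the locally nilpotent radical, the subgroup generated by all locally nilpotent normal subgroups of $G$ (a group is locally nilpotent if each finitely generated subgroup is nilpotent). The upper radical series of $G$ is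 the ascending transfinite series $1=R_0\subset R_1\subset\cdots\subset R_\alpha\subset\cdots$ with $R_{\alpha+1}/R_\alpha=R(G/R_\alpha)$ and unions taken at limit ordinals; its terminal member is $\widetilde R(G)$. *)

theory Defs
  imports "HOL-Algebra.Generated_Groups"
begin

definition commutator :: "('a, 'b) monoid_scheme \<Rightarrow> 'a \<Rightarrow> 'a \<Rightarrow> 'a" where
  "commutator G x y = inv\<^bsub>G\<^esub> x \<otimes>\<^bsub>G\<^esub> inv\<^bsub>G\<^esub> y \<otimes>\<^bsub>G\<^esub> x \<otimes>\<^bsub>G\<^esub> y"

text \<open>The value of the word \<open>e\<^sub>n\<close> at \<open>(x, y)\<close>. The harmless convention \<open>e\<^sub>0(x, y) = x\<close>
  gives \<open>e\<^sub>1(x, y) = [x, y]\<close>.\<close>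

primrec engel :: "('a, 'b) monoid_scheme \<Rightarrow> nat \<Rightarrow> 'a \<Rightarrow> 'a \<Rightarrow> 'a" where
  "engel G 0 x y = x"
| "engel G (Suc n) x y = commutator G (engel G n x y) y"

text \<open>\<open>eps G n x y k\<close> is the value of the word with indices \<open>n 1, \<dots>, n k\<close> at
  \<open>(x 1, \<dots>, x k; y)\<close>; the functions \<open>n\<close> and \<open>x\<close> are only used at the arguments \<open>1, \<dots>, k\<close>.\<close>

primrec eps :: "('a, 'b) monoid_scheme \<Rightarrow> (nat \<Rightarrow> nat) \<Rightarrow> (nat \<Rightarrow> 'a) \<Rightarrow> 'a \<Rightarrow> nat \<Rightarrow> 'a" where
  "eps G n x y 0 = y"
| "eps G n x y (Suc k) = engel G (n (Suc k)) (x (Suc k)) (eps G n x y k)"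

text \<open>Compatibility: the functions \<open>N\<^sub>i\<close>, defined on \<open>i\<close>-tuples, are packed into a single function
  \<open>N\<close> on nonempty lists, \<open>N\<^sub>i\<close> being its restriction to lists of length \<open>i\<close>. The value \<open>a 0\<close>
  of a sequence \<open>a 1, a 2, \<dots>\<close> is never used.\<close>

definition unbounded_quasi_nil :: "('a, 'b) monoid_scheme \<Rightarrow> 'a \<Rightarrow> bool" where
  "unbounded_quasi_nil G g \<longleftrightarrow> g \<in> carrier G \<and>
     (\<exists>N :: 'a list \<Rightarrow> nat.
        (\<forall>as. as \<noteq> [] \<and> set as \<subseteq> carrier G \<longrightarrow> N as \<ge> 1) \<and>
        (\<forall>a :: nat \<Rightarrow> 'a. (\<forall>i\<ge>1. a i \<in> carrier G) \<longrightarrow>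
           (\<exists>k\<ge>1. eps G (\<lambda>i. N (map a [1..<Suc i])) a g k = \<one>\<^bsub>G\<^esub>)))"

primrec lower_central :: "('a, 'b) monoid_scheme \<Rightarrow> nat \<Rightarrow> 'a set" where
  "lower_central G 0 = carrier G"
| "lower_central G (Suc n) =
     generate G {commutator G x y | x y. x \<in> lower_central G n \<and> y \<in> carrier G}"

definition nilpotent_group :: "('a, 'b) monoid_scheme \<Rightarrow> bool" where
  "nilpotent_group G \<longleftrightarrow> group G \<and> (\<exists>n. lower_central G n = {\<one>\<^bsub>G\<^esub>})"

definition locally_nilpotent :: "('a, 'b) monoid_scheme \<Rightarrow> bool" where
  "locally_nilpotent G \<longleftrightarrow> group G \<and>
     (\<forall>S. finite S \<and> S \<subseteq> carrier G \<longrightarrow> nilpotent_group (G\<lparr>carrier := generate G S\<rparr>))"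

definition hirsch_plotkin :: "('a, 'b) monoid_scheme \<Rightarrow> 'a set" where
  "hirsch_plotkin G = generate G (\<Union>{N. N \<lhd> G \<and> locally_nilpotent (G\<lparr>carrier := N\<rparr>)})"

text \<open>The subgroup \<open>K \<supseteq> H\<close> of \<open>G\<close> with \<open>K / H = HP(G / H)\<close>.\<close>

definition radical_above :: "('a, 'b) monoid_scheme \<Rightarrow> 'a set \<Rightarrow> 'a set" where
  "radical_above G H = {x \<in> carrier G. H #>\<^bsub>G\<^esub> x \<in> hirsch_plotkin (G Mod H)}"

text \<open>The upper radical series, indexed by the elements of a well-order \<open>r\<close> as ordinals:
  \<open>\<alpha>\<close> is the least element iff \<open>underS r \<alpha> = {}\<close>, and otherwise
  \<open>\<alpha>\<close> is the successor of \<open>\<beta>\<close> iff \<open>underS r \<alpha> = under r \<beta>\<close>.\<close>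

definition upper_radical_series ::
    "('a, 'b) monoid_scheme \<Rightarrow> 'i rel \<Rightarrow> 'i \<Rightarrow> 'a set" where
  "upper_radical_series G r = wo_rel.worec r (\<lambda>R \<alpha>.
     if underS r \<alpha> = {} then {\<one>\<^bsub>G\<^esub>}
     else if \<exists>\<beta>. underS r \<alpha> = under r \<beta>
       then radical_above G (R (THE \<beta>. underS r \<alpha> = under r \<beta>))
     else (\<Union>\<beta>\<in>underS r \<alpha>. R \<beta>))"

text \<open>The terms of the series with index below the successor cardinal of \<open>|G|\<close> suffice, since a
  strictly ascending series cannot be that long: \<open>upper_radical_terminal\<close> below shows
  that their union is the terminal member of the series.\<close>

definition upper_radical :: "('a, 'b) monoid_scheme \<Rightarrow> 'a set" where
  "upper_radical G =
     (\<Union>\<alpha> \<in> Field (cardSuc (card_of (carrier G))).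
        upper_radical_series G (cardSuc (card_of (carrier G))) \<alpha>)"

lemma under_inj:
  assumes "Well_order r" "under r \<beta> = under r \<gamma>" "under r \<beta> \<noteq> {}"
  shows "\<beta> = \<gamma>"
proof -
  have rf: "Refl r" and an: "antisym r"
    using assms(1) by (auto simp: order_on_defs)
  have "\<beta> \<in> Field r" "\<gamma> \<in> Field r"
    using assms(2,3) by (auto simp: under_def Field_def)
  then have "(\<beta>, \<beta>) \<in> r" "(\<gamma>, \<gamma>) \<in> r"
    using rf by (auto simp: refl_on_def)
  then have "(\<beta>, \<gamma>) \<in> r" "(\<gamma>, \<beta>) \<in> r"
    using assms(2) by (auto simp: under_def)
  then show ?thesis using an by (auto simp: antisym_def)
qed

lemma succ_in_underS:
  assumes "Well_order r" "underS r \<alpha> = under r \<beta>" "underS r \<alpha> \<noteq> {}"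
  shows "\<beta> \<in> underS r \<alpha>"
proof -
  have "\<beta> \<in> Field r" using assms(2,3) by (auto simp: under_def Field_def)
  then have "\<beta> \<in> under r \<beta>"
    using assms(1) by (auto simp: order_on_defs refl_on_def under_def)
  then show ?thesis using assms(2) by simp
qed

lemma the_succ:
  assumes "Well_order r" "underS r \<alpha> = under r \<beta>" "underS r \<alpha> \<noteq> {}"
  shows "(THE \<gamma>. underS r \<alpha> = under r \<gamma>) = \<beta>"
proof (rule the_equality[where P = "\<lambda>\<gamma>. underS r \<alpha> = under r \<gamma>", OF assms(2)])
  fix \<gamma> assume "underS r \<alpha> = under r \<gamma>"
  then show "\<gamma> = \<beta>" using under_inj[OF assms(1), of \<gamma> \<beta>] assms by simp
qed

lemma upper_radical_series_rec:
  assumes r: "Well_order r"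
  shows "upper_radical_series G r \<alpha> =
     (if underS r \<alpha> = {} then {\<one>\<^bsub>G\<^esub>}
      else if \<exists>\<beta>. underS r \<alpha> = under r \<beta>
        then radical_above G (upper_radical_series G r (THE \<beta>. underS r \<alpha> = under r \<beta>))
      else (\<Union>\<beta>\<in>underS r \<alpha>. upper_radical_series G r \<beta>))"
proof -
  let ?F = "\<lambda>R \<alpha>. if underS r \<alpha> = {} then {\<one>\<^bsub>G\<^esub>}
      else if \<exists>\<beta>. underS r \<alpha> = under r \<beta>
        then radical_above G (R (THE \<beta>. underS r \<alpha> = under r \<beta>))
      else (\<Union>\<beta>\<in>underS r \<alpha>. R \<beta>)"
  have wo: "wo_rel r" using r by (simp add: wo_rel_def)
  have "wo_rel.adm_wo r ?F"
    unfolding wo_rel.adm_wo_def[OF wo]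
  proof (intro allI impI)
    fix f g :: "'a \<Rightarrow> 'b set" and x
    assume eq: "\<forall>y\<in>underS r x. f y = g y"
    show "?F f x = ?F g x"
    proof (cases "underS r x \<noteq> {} \<and> (\<exists>\<beta>. underS r x = under r \<beta>)")
      case True
      then obtain \<beta> where "underS r x = under r \<beta>" by blast
      then have "f (THE \<gamma>. underS r x = under r \<gamma>) = g (THE \<gamma>. underS r x = under r \<gamma>)"
        using the_succ[OF r] succ_in_underS[OF r] True eq by metis
      then show ?thesis using eq by auto
    next
      case False
      then show ?thesis using eq by auto
    qed
  qed
  from wo_rel.worec_fixpoint[OF wo this] show ?thesis
    unfolding upper_radical_series_def by (rule fun_cong)
qed

lemma upper_radical_series_zero:
  "Well_order r \<Longrightarrow> underS r \<alpha> = {} \<Longrightarrow> upper_radical_series G r \<alpha> = {\<one>\<^bsub>G\<^esub>}"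
  by (subst upper_radical_series_rec) simp_all

lemma upper_radical_series_succ:
  assumes "Well_order r" "underS r \<alpha> = under r \<beta>" "underS r \<alpha> \<noteq> {}"
  shows "upper_radical_series G r \<alpha> = radical_above G (upper_radical_series G r \<beta>)"
  using the_succ[OF assms] assms by (subst upper_radical_series_rec) auto

lemma upper_radical_series_limit:
  assumes "Well_order r" "underS r \<alpha> \<noteq> {}" "\<nexists>\<beta>. underS r \<alpha> = under r \<beta>"
  shows "upper_radical_series G r \<alpha> = (\<Union>\<beta>\<in>underS r \<alpha>. upper_radical_series G r \<beta>)"
  using assms by (subst upper_radical_series_rec) auto

lemma hirsch_plotkin_normal:
  assumes "group G"
  shows "hirsch_plotkin G \<lhd> G"
proof -
  interpret group G by fact
  let ?U = "\<Union>{N. N \<lhd> G \<and> locally_nilpotent (G\<lparr>carrier := N\<rparr>)}"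
  have U: "?U \<subseteq> carrier G"
    using normal_imp_subgroup subgroup.subset by blast
  show ?thesis
    unfolding hirsch_plotkin_def
  proof (rule normal_generateI[OF U])
    fix h g assume "h \<in> ?U" "g \<in> carrier G"
    then show "g \<otimes>\<^bsub>G\<^esub> h \<otimes>\<^bsub>G\<^esub> inv\<^bsub>G\<^esub> g \<in> ?U"
      using normal.inv_op_closed2 by fastforce
  qed
qed

lemma radical_above_normal:
  assumes "group G" "H \<lhd> G"
  shows "radical_above G H \<lhd> G" "H \<subseteq> radical_above G H"
proof -
  interpret group G by fact
  interpret H: normal H G by fact
  let ?Q = "G Mod H"
  have gQ: "group ?Q" by (rule H.factorgroup_is_group)
  have K: "hirsch_plotkin ?Q \<lhd> ?Q" by (rule hirsch_plotkin_normal[OF gQ])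
  interpret h: group_hom G ?Q "\<lambda>x. H #>\<^bsub>G\<^esub> x"
    by (intro group_hom.intro group_hom_axioms.intro gQ H.r_coset_hom_Mod is_group)
  interpret K: normal "hirsch_plotkin ?Q" ?Q by fact
  have sub: "subgroup (radical_above G H) G"
  proof (rule subgroupI)
    show "radical_above G H \<subseteq> carrier G" by (auto simp: radical_above_def)
    have "\<one>\<^bsub>G\<^esub> \<in> radical_above G H"
      using h.hom_one K.one_closed unfolding radical_above_def by simp
    then show "radical_above G H \<noteq> {}" by blast
  qed (auto simp: radical_above_def simp del: one_FactGroup mult_FactGroup
         intro: K.m_closed K.m_inv_closed)
  show "radical_above G H \<lhd> G"
    unfolding normal_inv_iff
  proof (intro conjI ballI sub)
    fix x y assume xy: "x \<in> carrier G" "y \<in> radical_above G H"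
    then have "y \<in> carrier G" "H #>\<^bsub>G\<^esub> y \<in> hirsch_plotkin ?Q"
      by (auto simp: radical_above_def)
    with xy have "H #>\<^bsub>G\<^esub> (x \<otimes>\<^bsub>G\<^esub> y \<otimes>\<^bsub>G\<^esub> inv\<^bsub>G\<^esub> x) \<in> hirsch_plotkin ?Q"
      using K.inv_op_closed2[of "H #>\<^bsub>G\<^esub> x" "H #>\<^bsub>G\<^esub> y"]
      by (simp del: one_FactGroup mult_FactGroup)
    then show "x \<otimes>\<^bsub>G\<^esub> y \<otimes>\<^bsub>G\<^esub> inv\<^bsub>G\<^esub> x \<in> radical_above G H"
      using xy \<open>y \<in> carrier G\<close> by (simp add: radical_above_def)
  qed
  show "H \<subseteq> radical_above G H"
  proof
    fix x assume "x \<in> H"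
    then have "x \<in> carrier G" "H #>\<^bsub>G\<^esub> x = \<one>\<^bsub>?Q\<^esub>"
      by (auto simp: coset_join2 H.subgroup_axioms)
    then show "x \<in> radical_above G H"
      using K.one_closed by (simp add: radical_above_def)
  qed
qed

lemma normal_UNION_chain:
  assumes "group G" "I \<noteq> {}" "\<And>i. i \<in> I \<Longrightarrow> f i \<lhd> G"
    and "\<And>i j. i \<in> I \<Longrightarrow> j \<in> I \<Longrightarrow> f i \<subseteq> f j \<or> f j \<subseteq> f i"
  shows "(\<Union>i\<in>I. f i) \<lhd> G"
proof -
  interpret group G by fact
  have s: "subgroup (f i) G" if "i \<in> I" for i
    using assms(3)[OF that] by (rule normal_imp_subgroup)
  show ?thesis
    unfolding normal_inv_iff
  proof (intro conjI ballI subgroupI)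
    show "(\<Union>i\<in>I. f i) \<subseteq> carrier G" using s subgroup.subset by blast
    show "(\<Union>i\<in>I. f i) \<noteq> {}" using s assms(2) subgroup.one_closed by blast
    show "inv\<^bsub>G\<^esub> x \<in> (\<Union>i\<in>I. f i)" if "x \<in> (\<Union>i\<in>I. f i)" for x
      using that subgroup.m_inv_closed[OF s] by (auto 4 4)
    show "x \<otimes>\<^bsub>G\<^esub> y \<in> (\<Union>i\<in>I. f i)"
      if xy: "x \<in> (\<Union>i\<in>I. f i)" "y \<in> (\<Union>i\<in>I. f i)" for x y
    proof -
      obtain i j where ij: "i \<in> I" "j \<in> I" "x \<in> f i" "y \<in> f j" using xy by blast
      then have "x \<in> f j \<and> y \<in> f j \<or> x \<in> f i \<and> y \<in> f i" using assms(4) by blast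
      then show ?thesis using ij subgroup.m_closed[OF s] by (auto 4 4)
    qed
    show "x \<otimes>\<^bsub>G\<^esub> h \<otimes>\<^bsub>G\<^esub> inv\<^bsub>G\<^esub> x \<in> (\<Union>i\<in>I. f i)"
      if "x \<in> carrier G" "h \<in> (\<Union>i\<in>I. f i)" for x h
      using that normal.inv_op_closed2[OF assms(3)] by (auto 4 4)
  qed
qed

lemma upper_radical_series_ascending:
  assumes G: "group G" and r: "Well_order r"
  shows "upper_radical_series G r \<alpha> \<lhd> G \<and>
    (\<forall>\<beta>\<in>underS r \<alpha>. upper_radical_series G r \<beta> \<subseteq> upper_radical_series G r \<alpha> \<and>
       radical_above G (upper_radical_series G r \<beta>) \<subseteq> upper_radical_series G r \<alpha>)"
proof -
  let ?R = "upper_radical_series G r"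
  have wo: "wo_rel r" using r by (simp add: wo_rel_def)
  have tot: "\<And>x y. x \<in> Field r \<Longrightarrow> y \<in> Field r \<Longrightarrow> x = y \<or> x \<in> underS r y \<or> y \<in> underS r x"
    using wo_rel.TOTALS[OF wo] by (auto simp: underS_def)
  have FS: "underS r x \<subseteq> Field r" for x by (auto simp: underS_def Field_def)
  show ?thesis
  proof (induction \<alpha> rule: wo_rel.well_order_induct[OF wo])
    case (1 \<alpha>)
    have IH: "?R \<beta> \<lhd> G" "\<And>\<gamma>. \<gamma> \<in> underS r \<beta> \<Longrightarrow> ?R \<gamma> \<subseteq> ?R \<beta>"
      "\<And>\<gamma>. \<gamma> \<in> underS r \<beta> \<Longrightarrow> radical_above G (?R \<gamma>) \<subseteq> ?R \<beta>"
      if "\<beta> \<in> underS r \<alpha>" for \<beta>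
      using 1 that by (auto simp: underS_def)
    consider "underS r \<alpha> = {}" | \<beta> where "underS r \<alpha> \<noteq> {}" "underS r \<alpha> = under r \<beta>"
      | "underS r \<alpha> \<noteq> {}" "\<nexists>\<beta>. underS r \<alpha> = under r \<beta>" by blast
    then show ?case
    proof cases
      case 1
      then show ?thesis
        using upper_radical_series_zero[OF r 1, of G] group.one_is_normal[OF G] by simp
    next
      case 2
      have b: "\<beta> \<in> underS r \<alpha>" using succ_in_underS[OF r] 2 by blast
      have eq: "?R \<alpha> = radical_above G (?R \<beta>)" by (rule upper_radical_series_succ[OF r 2(2,1)])
      have N: "?R \<alpha> \<lhd> G" "?R \<beta> \<subseteq> ?R \<alpha>"
        unfolding eq using radical_above_normal[OF G IH(1)[OF b]] by auto
      have "?R \<gamma> \<subseteq> ?R \<alpha> \<and> radical_above G (?R \<gamma>) \<subseteq> ?R \<alpha>" if "\<gamma> \<in> underS r \<alpha>" for \<gamma>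
      proof (cases "\<gamma> = \<beta>")
        case True
        then show ?thesis using N eq by simp
      next
        case False
        then have "\<gamma> \<in> underS r \<beta>" using that 2 by (auto simp: under_def underS_def)
        then show ?thesis using IH(2,3)[OF b] N by blast
      qed
      with N show ?thesis by blast
    next
      case 3
      have eq: "?R \<alpha> = (\<Union>\<beta>\<in>underS r \<alpha>. ?R \<beta>)" using upper_radical_series_limit[OF r 3] .
      have N: "?R \<alpha> \<lhd> G"
        unfolding eq
      proof (rule normal_UNION_chain[OF G 3(1) IH(1)])
        fix i j assume "i \<in> underS r \<alpha>" "j \<in> underS r \<alpha>"
        then show "?R i \<subseteq> ?R j \<or> ?R j \<subseteq> ?R i" using tot[of i j] FS IH(2) by blast
      qed
      have "radical_above G (?R \<beta>) \<subseteq> ?R \<alpha>" if b: "\<beta> \<in> underS r \<alpha>" for \<beta>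
      proof -
        have "under r \<beta> \<subseteq> underS r \<alpha>"
          using b wo_rel.TRANS[OF wo] wo_rel.ANTISYM[OF wo]
          unfolding under_def underS_def by (auto dest: transD antisymD)
        then obtain \<gamma> where g: "\<gamma> \<in> underS r \<alpha>" "\<gamma> \<notin> under r \<beta>" using 3(2) by blast
        have "\<beta> \<in> Field r" using b FS by blast
        then have "(\<beta>, \<beta>) \<in> r" using wo_rel.REFL[OF wo] by (auto simp: refl_on_def)
        then have "\<beta> \<in> underS r \<gamma>"
          using tot[of \<beta> \<gamma>] \<open>\<beta> \<in> Field r\<close> g FS by (auto simp: under_def underS_def)
        then show ?thesis using IH(3) g eq by blast
      qed
      with N eq show ?thesis by blast
    qed
  qed
qed

theorem upper_radical_terminal:
  assumes G: "group G"
  shows "\<exists>\<alpha> \<in> Field (cardSuc (card_of (carrier G))).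
      upper_radical G = upper_radical_series G (cardSuc (card_of (carrier G))) \<alpha>"
    and "hirsch_plotkin (G Mod upper_radical G) = {\<one>\<^bsub>G Mod upper_radical G\<^esub>}"
proof -
  define r where "r = cardSuc (card_of (carrier G))"
  let ?R = "upper_radical_series G r"
  have C: "Card_order r" unfolding r_def by (simp add: cardSuc_Card_order card_of_Card_order)
  then have r: "Well_order r" by (simp add: card_order_on_def)
  have wo: "wo_rel r" using r by (simp add: wo_rel_def)
  note asc = upper_radical_series_ascending[OF G r]
  have tot: "\<And>x y. x \<in> Field r \<Longrightarrow> y \<in> Field r \<Longrightarrow> x = y \<or> x \<in> underS r y \<or> y \<in> underS r x"
    using wo_rel.TOTALS[OF wo] by (auto simp: underS_def)
  have "\<exists>\<alpha>\<in>Field r. radical_above G (?R \<alpha>) = ?R \<alpha>"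
  proof (rule ccontr)
    assume *: "\<not> ?thesis"
    have "\<exists>x. x \<in> radical_above G (?R \<alpha>) \<and> x \<notin> ?R \<alpha>" if "\<alpha> \<in> Field r" for \<alpha>
      using * that radical_above_normal(2)[OF G] asc by blast
    then obtain f where f: "\<And>\<alpha>. \<alpha> \<in> Field r \<Longrightarrow> f \<alpha> \<in> radical_above G (?R \<alpha>) \<and> f \<alpha> \<notin> ?R \<alpha>"
      by metis
    have "inj_on f (Field r)"
    proof (rule inj_onI, rule ccontr)
      fix x y assume "x \<in> Field r" "y \<in> Field r" "f x = f y" "x \<noteq> y"
      then show False using tot[of x y] f asc by (metis subsetD)
    qed
    moreover have "f ` Field r \<subseteq> carrier G" using f by (auto simp: radical_above_def)
    ultimately have "ordLeq3 (card_of (Field r)) (card_of (carrier G))"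
      using card_of_ordLeq by blast
    moreover have "ordIso2 (card_of (Field r)) r" using C card_of_Field_ordIso by blast
    moreover have "ordLess2 (card_of (carrier G)) r"
      unfolding r_def by (rule cardSuc_greater[OF card_of_Card_order])
    ultimately show False
      by (meson not_ordLess_ordLeq ordIso_ordLeq_trans ordIso_symmetric)
  qed
  then obtain \<alpha> where a: "\<alpha> \<in> Field r" "radical_above G (?R \<alpha>) = ?R \<alpha>" by blast
  have le: "\<beta> \<in> Field r \<longrightarrow> ?R \<beta> \<subseteq> ?R \<alpha>" for \<beta>
  proof (induction \<beta> rule: wo_rel.well_order_induct[OF wo])
    case (1 \<beta>)
    have IH: "?R \<gamma> \<subseteq> ?R \<alpha>" if "\<gamma> \<in> underS r \<beta>" for \<gamma>
      using 1 that by (auto simp: underS_def Field_def)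
    show ?case
    proof
      assume b: "\<beta> \<in> Field r"
      consider "\<beta> = \<alpha>" | "\<beta> \<in> underS r \<alpha>" | "\<alpha> \<in> underS r \<beta>" using tot[OF b a(1)] by blast
      then show "?R \<beta> \<subseteq> ?R \<alpha>"
      proof cases
        case 3
        show ?thesis
        proof (cases "\<exists>\<gamma>. underS r \<beta> = under r \<gamma>")
          case True
          then obtain \<gamma> where g: "underS r \<beta> = under r \<gamma>" by blast
          have gb: "\<gamma> \<in> underS r \<beta>" using succ_in_underS[OF r g] 3 by blast
          have "\<alpha> = \<gamma> \<or> \<alpha> \<in> underS r \<gamma>" using 3 g by (auto simp: under_def underS_def)
          then have "?R \<gamma> = ?R \<alpha>" using asc IH[OF gb] by blast
          then show ?thesis using upper_radical_series_succ[OF r g, of G] 3 a by auto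
        next
          case False
          then have "?R \<beta> = (\<Union>\<gamma>\<in>underS r \<beta>. ?R \<gamma>)"
            using upper_radical_series_limit[OF r, of \<beta> G] 3 by auto
          then show ?thesis using IH by auto
        qed
      qed (use asc in auto)
    qed
  qed
  have eq: "upper_radical G = ?R \<alpha>"
    unfolding upper_radical_def r_def[symmetric] using le a by blast
  then show "\<exists>\<alpha> \<in> Field (cardSuc (card_of (carrier G))).
      upper_radical G = upper_radical_series G (cardSuc (card_of (carrier G))) \<alpha>"
    using a unfolding r_def by blast
  have N: "?R \<alpha> \<lhd> G" using asc by blast
  interpret N: normal "?R \<alpha>" G by (rule N)
  let ?Q = "G Mod ?R \<alpha>"
  have K: "subgroup (hirsch_plotkin ?Q) ?Q"
    by (intro normal_imp_subgroup hirsch_plotkin_normal N.factorgroup_is_group)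
  have "X = ?R \<alpha>" if X: "X \<in> hirsch_plotkin ?Q" for X
  proof -
    have "X \<in> carrier ?Q" using X subgroup.subset[OF K] by blast
    then obtain x where x: "x \<in> carrier G" "X = ?R \<alpha> #>\<^bsub>G\<^esub> x"
      by (auto simp: carrier_FactGroup)
    then have "x \<in> ?R \<alpha>" using a(2) X unfolding radical_above_def by blast
    then show ?thesis using x by (simp add: N.coset_join2 N.subgroup_axioms)
  qed
  moreover have "?R \<alpha> \<in> hirsch_plotkin ?Q" using subgroup.one_closed[OF K] by simp
  ultimately show "hirsch_plotkin (G Mod upper_radical G) = {\<one>\<^bsub>G Mod upper_radical G\<^esub>}"
    unfolding eq by auto
qed

end

theory Submission
  imports Defs
begin

text \<open>
  A descent along the radical series shows that every element of the terminal member is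
  unbounded quasi-nil once it is known that each element of the Hirsch-Plotkin radical of a group
  is a left Engel element: applied to \<open>G / R\<^sub>\<beta>\<close>, this gives for \<open>u \<in> R\<^bsub>\<beta>+1\<^esub>\<close> and any \<open>a\<close>
  an \<open>n\<close> with \<open>e\<^sub>n(a, u) \<in> R\<^sub>\<beta>\<close>, and ordinals admit no infinite descent.

  For the Engel property the Hirsch-Plotkin theorem can be avoided. It suffices that \<open>u = w v\<close> is
  left Engel whenever \<open>v\<close> is and \<open>w\<close> lies in a locally nilpotent normal subgroup \<open>N\<close>. Modulo \<open>N\<close>
  the elements \<open>u\<close> and \<open>v\<close> agree, so \<open>b = e\<^sub>n(a, u) \<in> N\<close> for some \<open>n\<close>. The finitely many
  nontrivial elements \<open>e\<^sub>j(b, v)\<close> and \<open>e\<^sub>j(w, v)\<close> generate a nilpotent subgroup \<open>P\<close> of \<open>N\<close> which is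
  mapped into itself under conjugation by \<open>v\<close>. On each lower central factor of \<open>P\<close> the elements
  \<open>u\<close> and \<open>v\<close> act alike, because \<open>w \<in> P\<close> acts trivially; since \<open>v\<close> is left Engel, repeated
  commutation with \<open>u\<close> moves \<open>b\<close> down the lower central series of \<open>P\<close> to \<open>1\<close>.
\<close>

section \<open>Commutators and Engel words\<close>

context group
begin

lemma mult_inv_cancel_left:
  assumes "x \<in> carrier G" "y \<in> carrier G"
  shows "x \<otimes> (inv x \<otimes> y) = y" "inv x \<otimes> (x \<otimes> y) = y"
  using assms by (simp_all flip: m_assoc)

text \<open>Together these bring group words into right-associated, cancelled form, so that the
  commutator identities below are settled by simplification.\<close>

lemmas word_simps = m_assoc inv_mult_group mult_inv_cancel_left

lemma commutator_closed [simp, intro]: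
  "x \<in> carrier G \<Longrightarrow> y \<in> carrier G \<Longrightarrow> commutator G x y \<in> carrier G"
  by (simp add: commutator_def)

lemma commutator_one_left [simp]: "y \<in> carrier G \<Longrightarrow> commutator G \<one> y = \<one>"
  by (simp add: commutator_def)

lemma commutator_one_right [simp]: "x \<in> carrier G \<Longrightarrow> commutator G x \<one> = \<one>"
  by (simp add: commutator_def)

lemma engel_closed [simp, intro]:
  "x \<in> carrier G \<Longrightarrow> y \<in> carrier G \<Longrightarrow> engel G n x y \<in> carrier G"
  by (induction n) auto

lemma engel_one_left [simp]: "y \<in> carrier G \<Longrightarrow> engel G n \<one> y = \<one>"
  by (induction n) auto

end

lemma engel_add: "engel G (m + n) x y = engel G m (engel G n x y) y"
  by (induction m) auto

lemma (in group_hom) hom_commutator: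
  "x \<in> carrier G \<Longrightarrow> y \<in> carrier G \<Longrightarrow> h (commutator G x y) = commutator H (h x) (h y)"
  by (simp add: commutator_def)

lemma (in group_hom) hom_engel:
  "x \<in> carrier G \<Longrightarrow> y \<in> carrier G \<Longrightarrow> h (engel G n x y) = engel H n (h x) (h y)"
  by (induction n) (simp_all add: hom_commutator)

lemma (in group) commutator_subgroup:
  assumes "subgroup P G" "x \<in> P" "y \<in> P"
  shows "commutator (G\<lparr>carrier := P\<rparr>) x y = commutator G x y"
  using assms by (simp add: commutator_def m_inv_consistent)

lemma (in normal) commutator_in:
  assumes "x \<in> H" "y \<in> carrier G"
  shows "commutator G x y \<in> H"
proof -
  have "inv x \<otimes> (inv y \<otimes> x \<otimes> y) \<in> H"
    using assms inv_op_closed1 by auto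
  then show ?thesis
    using assms by (simp add: commutator_def m_assoc)
qed

section \<open>The lower central series\<close>

context group
begin

lemma lower_central_subgroup: "subgroup (lower_central G n) G"
proof (induction n)
  case 0
  show ?case by (simp add: subgroup_self)
next
  case (Suc n)
  then have "lower_central G n \<subseteq> carrier G" by (rule subgroup.subset)
  then show ?case by (auto intro!: generate_is_subgroup)
qed

lemma lower_central_subset: "lower_central G n \<subseteq> carrier G"
  by (rule subgroup.subset[OF lower_central_subgroup])

lemma commutator_lower_central:
  "x \<in> lower_central G n \<Longrightarrow> y \<in> carrier G \<Longrightarrow> commutator G x y \<in> lower_central G (Suc n)"
  by (auto intro!: generate.incl)

lemma lower_central_Suc_subset: "lower_central G (Suc n) \<subseteq> lower_central G n"
proof (induction n)
  case 0
  show ?case using lower_central_subset[of "Suc 0"] by simp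
next
  case (Suc n)
  show ?case
    unfolding lower_central.simps(2)[of G "Suc n"]
  proof (rule generate_subgroup_incl[OF _ lower_central_subgroup])
    show "{commutator G x y |x y. x \<in> lower_central G (Suc n) \<and> y \<in> carrier G}
        \<subseteq> lower_central G (Suc n)"
      using Suc commutator_lower_central by blast
  qed
qed

end

text \<open>Used for conjugation by an element that maps a subgroup into itself: it then maps every
  lower central term of that subgroup into itself.\<close>

lemma (in group_hom) hom_lower_central:
  "x \<in> lower_central G n \<Longrightarrow> h x \<in> lower_central H n"
proof (induction n arbitrary: x)
  case 0
  then show ?case by simp
next
  case (Suc n)
  let ?S = "{commutator G x y |x y. x \<in> lower_central G n \<and> y \<in> carrier G}"
  have S: "?S \<subseteq> carrier G" using G.lower_central_subset by blast
  have "h ` ?S \<subseteq> lower_central H (Suc n)"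
  proof clarify
    fix x y assume xy: "x \<in> lower_central G n" "y \<in> carrier G"
    moreover from xy have "x \<in> carrier G" using G.lower_central_subset by blast
    ultimately show "h (commutator G x y) \<in> lower_central H (Suc n)"
      using H.commutator_lower_central[OF Suc.IH] by (simp add: hom_commutator del: lower_central.simps)
  qed
  then have "generate H (h ` ?S) \<subseteq> lower_central H (Suc n)"
    by (rule H.generate_subgroup_incl[OF _ H.lower_central_subgroup])
  moreover have "h x \<in> h ` generate G ?S" using Suc.prems by auto
  ultimately show ?case unfolding generate_img[OF S, symmetric] by blast
qed

section \<open>Left Engel elements\<close>

definition left_engel :: "('a, 'b) monoid_scheme \<Rightarrow> 'a \<Rightarrow> bool" where
  "left_engel G v \<longleftrightarrow> v \<in> carrier G \<and> (\<forall>a\<in>carrier G. \<exists>n. engel G n a v = \<one>\<^bsub>G\<^esub>)"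

context group
begin

text \<open>Maps that agree on \<open>A\<close> modulo \<open>B\<close> have iterates that agree
  modulo \<open>B\<close>, as long as the error term in \<open>B\<close> survives each step. It is
  applied with consecutive lower central terms as \<open>A\<close> and \<open>B\<close>.\<close>

lemma engel_congruent:
  assumes A: "subgroup A G" and B: "subgroup B G" and uv: "u \<in> carrier G" "v \<in> carrier G"
    and AB: "\<And>x z. x \<in> A \<Longrightarrow> z \<in> B \<Longrightarrow> inv x \<otimes> z \<otimes> x \<in> B"
    and Av: "\<And>x. x \<in> A \<Longrightarrow> commutator G x v \<in> A"
    and Bu: "\<And>z. z \<in> B \<Longrightarrow> inv u \<otimes> z \<otimes> u \<in> B"
    and agree: "\<And>x. x \<in> A \<Longrightarrow> inv (commutator G x v) \<otimes> commutator G x u \<in> B"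
    and x: "x \<in> A"
  shows "engel G n x v \<in> A \<and> inv (engel G n x v) \<otimes> engel G n x u \<in> B"
proof (induction n)
  case 0
  show ?case using x subgroup.mem_carrier[OF A x] subgroup.one_closed[OF B] by simp
next
  case (Suc n)
  define y z where "y = engel G n x v" and "z = inv y \<otimes> engel G n x u"
  have yA: "y \<in> A" and zB: "z \<in> B" using Suc by (simp_all add: y_def z_def)
  have car: "x \<in> carrier G" "y \<in> carrier G" "z \<in> carrier G"
    using x yA zB subgroup.subset[OF A] subgroup.subset[OF B] by auto
  have yu: "engel G n x u = y \<otimes> z"
    using car uv by (simp add: z_def mult_inv_cancel_left)
  let ?c = "commutator G y v"
  \<comment> \<open>Expand \<open>commutator G (y \<otimes> z) u\<close> as \<open>inv z \<otimes>
    commutator G y u \<otimes> (inv u \<otimes> z \<otimes> u)\<close>. The three factors lie in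
    \<open>B\<close> by \<open>AB\<close>, \<open>agree\<close> and \<open>Bu\<close>
    respectively.\<close>
  have "inv ?c \<otimes> commutator G (y \<otimes> z) u =
      (inv ?c \<otimes> inv z \<otimes> ?c) \<otimes> (inv ?c \<otimes> commutator G y u) \<otimes> (inv u \<otimes> z \<otimes> u)"
    using car uv by (simp add: commutator_def word_simps)
  moreover have "\<dots> \<in> B"
    by (intro subgroup.m_closed[OF B] AB Av Bu agree yA zB subgroup.m_inv_closed[OF B])
  ultimately show ?case using Av[OF yA] yu by (simp add: y_def)
qed

text \<open>For \<open>x\<close> in \<open>?C i\<close>, some \<open>n\<close> gives
  \<open>engel G n x v = \<one>\<close>; by congruence modulo \<open>?C (Suc i)\<close> the same
  \<open>n\<close> takes \<open>x\<close> into \<open>?C (Suc i)\<close> when \<open>v\<close> is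
  replaced by \<open>w \<otimes> v\<close>. Nilpotency of \<open>P\<close> bounds the number of such
  descents.\<close>

lemma left_engel_mult_nilpotent:
  assumes P: "subgroup P G" and nil: "nilpotent_group (G\<lparr>carrier := P\<rparr>)"
    and v: "left_engel G v" and inv: "\<And>x. x \<in> P \<Longrightarrow> inv v \<otimes> x \<otimes> v \<in> P"
    and w: "w \<in> P" and b: "b \<in> P"
  shows "\<exists>n. engel G n b (w \<otimes> v) = \<one>"
proof -
  define Q where "Q = G\<lparr>carrier := P\<rparr>"
  interpret Q: group Q unfolding Q_def by (rule subgroup_imp_group[OF P])
  let ?C = "lower_central Q" and ?u = "w \<otimes> v"
  have PQ: "carrier Q = P" by (simp add: Q_def)
  have vc: "v \<in> carrier G" using v by (simp add: left_engel_def)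
  have Pc: "P \<subseteq> carrier G" by (rule subgroup.subset[OF P])
  have wc: "w \<in> carrier G" using w Pc by blast
  have CP: "?C i \<subseteq> P" for i using Q.lower_central_subset PQ by blast
  have Cc: "x \<in> carrier G" if "x \<in> ?C i" for x i using CP Pc that by blast
  have C: "subgroup (?C i) G" for i
    using Q.lower_central_subgroup[of i] incl_subgroup[OF P] unfolding Q_def by blast
  have com: "commutator G x y \<in> ?C (Suc i)" if "x \<in> ?C i" "y \<in> P" for x y i
    using Q.commutator_lower_central[of x i y] that CP[of i] commutator_subgroup[OF P, of x y] PQ
    unfolding Q_def by auto
  have dec: "?C (Suc i) \<subseteq> ?C i" for i by (rule Q.lower_central_Suc_subset)
  have conjP: "inv y \<otimes> z \<otimes> y \<in> ?C i" if "z \<in> ?C i" "y \<in> P" for y z i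
  proof -
    have "inv y \<otimes> z \<otimes> y = z \<otimes> commutator G z y"
      using that Cc Pc by (auto simp: commutator_def word_simps)
    then show ?thesis using subgroup.m_closed[OF C that(1)] com[OF that] dec by auto
  qed
  \<comment> \<open>Conjugation by \<open>v\<close> is only known to map \<open>P\<close> into
    \<open>P\<close>, so it is treated as an endomorphism of \<open>Q\<close> rather than an
    automorphism.\<close>
  interpret conj: group_hom Q Q "\<lambda>x. inv v \<otimes> x \<otimes> v"
  proof unfold_locales
    show "(\<lambda>x. inv v \<otimes> x \<otimes> v) \<in> hom Q Q"
      using inv Pc vc by (auto simp: hom_def Q_def word_simps subset_iff)
  qed
  have conjv: "inv v \<otimes> z \<otimes> v \<in> ?C i" if "z \<in> ?C i" for z i
    using conj.hom_lower_central[OF that] .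
  have step: "\<exists>n. engel G n x ?u \<in> ?C (Suc i)" if x: "x \<in> ?C i" for x i
  proof -
    obtain n where n: "engel G n x v = \<one>" using v Cc[OF x] by (auto simp: left_engel_def)
    have "engel G n x v \<in> ?C i \<and> inv (engel G n x v) \<otimes> engel G n x ?u \<in> ?C (Suc i)"
    proof (rule engel_congruent[OF C C _ vc _ _ _ _ x])
      show "?u \<in> carrier G" using wc vc by simp
      fix y assume y: "y \<in> ?C i"
      then have yc: "y \<in> carrier G" by (rule Cc)
      show "inv y \<otimes> z \<otimes> y \<in> ?C (Suc i)" if "z \<in> ?C (Suc i)" for z
        using conjP[OF that] y CP by blast
      have "commutator G y v = inv y \<otimes> (inv v \<otimes> y \<otimes> v)"
        using yc vc by (simp add: commutator_def word_simps)
      then show "commutator G y v \<in> ?C i"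
        using subgroup.m_closed[OF C subgroup.m_inv_closed[OF C y] conjv[OF y]] by simp
      \<comment> \<open>This is the identity for a commutator with a product on the right. Since
        \<open>w \<in> P\<close>, the factor \<open>commutator G y w\<close> already lies in the
        next lower central term.\<close>
      have "inv (commutator G y v) \<otimes> commutator G y ?u = inv v \<otimes> commutator G y w \<otimes> v"
        using yc vc wc by (simp add: commutator_def word_simps)
      then show "inv (commutator G y v) \<otimes> commutator G y ?u \<in> ?C (Suc i)"
        using conjv[OF com[OF y w]] by simp
    next
      fix z assume z: "z \<in> ?C (Suc i)"
      have "inv ?u \<otimes> z \<otimes> ?u = inv v \<otimes> (inv w \<otimes> z \<otimes> w) \<otimes> v"
        using Cc[OF z] vc wc by (simp add: word_simps)
      then show "inv ?u \<otimes> z \<otimes> ?u \<in> ?C (Suc i)"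
        using conjv[OF conjP[OF z w]] by simp
    qed
    then show ?thesis using n Cc[OF x] vc wc by auto
  qed
  have "\<exists>n. engel G n b ?u \<in> ?C i" for i
  proof (induction i)
    case 0
    have "engel G 0 b ?u \<in> ?C 0" using b PQ by simp
    then show ?case by blast
  next
    case (Suc i)
    then show ?case using step engel_add by metis
  qed
  moreover obtain c where "?C c = {\<one>}"
    using nil by (auto simp: nilpotent_group_def Q_def)
  ultimately show ?thesis by (metis singletonD)
qed

text \<open>The Engel sequence of each \<open>x \<in> F\<close> reaches \<open>\<one>\<close> at
  index \<open>m x\<close>, so finitely many terms, all in \<open>N\<close>, form a set that
  commutation with \<open>v\<close> leaves invariant up to \<open>\<one>\<close>. Local nilpotency
  applies to the subgroup they generate.\<close>

lemma nilpotent_envelope: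
  assumes N: "N \<lhd> G" and nil: "locally_nilpotent (G\<lparr>carrier := N\<rparr>)"
    and v: "left_engel G v" and F: "finite F" "F \<subseteq> N"
  obtains P where "subgroup P G" "nilpotent_group (G\<lparr>carrier := P\<rparr>)" "F \<subseteq> P"
    "\<And>x. x \<in> P \<Longrightarrow> inv v \<otimes> x \<otimes> v \<in> P"
proof -
  interpret N: normal N G by (rule N)
  have vc: "v \<in> carrier G" using v by (simp add: left_engel_def)
  have Fc: "F \<subseteq> carrier G" using F(2) N.subset by (rule subset_trans)
  have "\<forall>x\<in>F. \<exists>m. engel G m x v = \<one>" using v Fc unfolding left_engel_def by blast
  then obtain m where m: "\<And>x. x \<in> F \<Longrightarrow> engel G (m x) x v = \<one>" by metis
  define S where "S = (\<Union>x\<in>F. (\<lambda>j. engel G j x v) ` {..m x})"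
  have "engel G j x v \<in> N" if "x \<in> N" for x j
    by (induction j) (use that N.commutator_in vc in auto)
  then have SN: "S \<subseteq> N" using F by (auto simp: S_def)
  then have Sc: "S \<subseteq> carrier G" using N.subset by blast
  have "finite S" using F by (auto simp: S_def)
  let ?P = "generate G S"
  have P: "subgroup ?P G" by (rule generate_is_subgroup[OF Sc])
  have "nilpotent_group (G\<lparr>carrier := N, carrier := generate (G\<lparr>carrier := N\<rparr>) S\<rparr>)"
    using nil SN \<open>finite S\<close> by (simp add: locally_nilpotent_def)
  then have nilP: "nilpotent_group (G\<lparr>carrier := ?P\<rparr>)"
    using generate_consistent[OF SN N.subgroup_axioms] by simp
  have FP: "F \<subseteq> ?P"
  proof
    fix x assume "x \<in> F"
    moreover have "x \<in> (\<lambda>j. engel G j x v) ` {..m x}" by (rule image_eqI[of _ _ 0]) simp_all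
    ultimately have "x \<in> S" unfolding S_def by blast
    then show "x \<in> ?P" by (rule generate.incl)
  qed
  interpret conj: group_hom G G "\<lambda>x. inv v \<otimes> x \<otimes> v"
    by unfold_locales (use vc in \<open>auto simp: hom_def word_simps\<close>)
  have "(\<lambda>x. inv v \<otimes> x \<otimes> v) ` S \<subseteq> ?P"
  proof clarify
    fix s assume "s \<in> S"
    then obtain x j where x: "x \<in> F" "j \<le> m x" "s = engel G j x v" by (auto simp: S_def)
    have xc: "x \<in> carrier G" using x(1) Fc by blast
    \<comment> \<open>The conjugate of \<open>s\<close> by \<open>v\<close> is
      \<open>s \<otimes> commutator G s v\<close>, and this commutator is the next term of the Engel
      sequence.\<close>
    have "engel G (Suc j) x v \<in> ?P"
    proof (cases "j = m x")
      case True
      then show ?thesis using m[OF x(1)] vc generate.one by simp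
    next
      case False
      then have "Suc j \<in> {..m x}" using x(2) by simp
      then have "engel G (Suc j) x v \<in> S" unfolding S_def using x(1) by blast
      then show ?thesis by (rule generate.incl)
    qed
    with generate.incl[OF \<open>s \<in> S\<close>] have "s \<otimes> engel G (Suc j) x v \<in> ?P"
      by (rule generate.eng)
    moreover have "s \<otimes> engel G (Suc j) x v = inv v \<otimes> s \<otimes> v"
      unfolding x(3) engel.simps using xc vc
      by (simp add: commutator_def word_simps)
    ultimately show "inv v \<otimes> s \<otimes> v \<in> ?P" by simp
  qed
  then have "generate G ((\<lambda>x. inv v \<otimes> x \<otimes> v) ` S) \<subseteq> ?P"
    by (rule generate_subgroup_incl[OF _ P])
  then have "inv v \<otimes> x \<otimes> v \<in> ?P" if "x \<in> ?P" for x
    using that conj.generate_img[OF Sc] by blast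
  with P nilP FP that show ?thesis by blast
qed

text \<open>As \<open>N\<close> may change from one application to the next, products of elements
  from different locally nilpotent normal subgroups are handled one factor at a time.\<close>

lemma left_engel_mult:
  assumes N: "N \<lhd> G" and nil: "locally_nilpotent (G\<lparr>carrier := N\<rparr>)"
    and v: "left_engel G v" and w: "w \<in> N"
  shows "left_engel G (w \<otimes> v)"
proof -
  interpret N: normal N G by (rule N)
  have vc: "v \<in> carrier G" using v by (simp add: left_engel_def)
  have wc: "w \<in> carrier G" using w by simp
  interpret q: group_hom G "G Mod N" "\<lambda>x. N #> x"
    by (intro group_hom.intro group_hom_axioms.intro N.factorgroup_is_group
        N.r_coset_hom_Mod is_group)
  have "\<exists>n. engel G n a (w \<otimes> v) = \<one>" if a: "a \<in> carrier G" for a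
  proof -
    obtain n where n: "engel G n a v = \<one>" using v a by (auto simp: left_engel_def)
    have "N #> (w \<otimes> v) = N #> v"
      using coset_mult_assoc[OF N.subset wc vc] coset_join2[OF wc N.subgroup_axioms w] by simp
    then have "N #> engel G n a (w \<otimes> v) = N #> engel G n a v"
      unfolding q.hom_engel[OF a vc] q.hom_engel[OF a m_closed[OF wc vc]] by simp
    then have "N #> engel G n a (w \<otimes> v) = N" using n by (simp add: coset_mult_one N.subset)
    then have b: "engel G n a (w \<otimes> v) \<in> N"
      using coset_join1[OF _ _ N.subgroup_axioms] a vc wc by simp
    obtain P where "subgroup P G" "nilpotent_group (G\<lparr>carrier := P\<rparr>)"
      "{w, engel G n a (w \<otimes> v)} \<subseteq> P" "\<And>x. x \<in> P \<Longrightarrow> inv v \<otimes> x \<otimes> v \<in> P"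
      using nilpotent_envelope[OF N nil v, of "{w, engel G n a (w \<otimes> v)}"] w b by auto
    then obtain k where "engel G k (engel G n a (w \<otimes> v)) (w \<otimes> v) = \<one>"
      using left_engel_mult_nilpotent[OF _ _ v] by (metis insert_subset)
    then show ?thesis by (metis engel_add)
  qed
  then show ?thesis using vc wc by (simp add: left_engel_def)
qed

text \<open>Induction over the generated subgroup proves a form that composes along products: left
  multiplication by \<open>u\<close> preserves left Engel elements. Applying it to
  \<open>\<one>\<close> gives the claim.\<close>

lemma left_engel_hirsch_plotkin:
  assumes "u \<in> hirsch_plotkin G"
  shows "left_engel G u"
proof -
  let ?U = "\<Union>{N. N \<lhd> G \<and> locally_nilpotent (G\<lparr>carrier := N\<rparr>)}"
  have U: "?U \<subseteq> carrier G" using normal_imp_subgroup subgroup.subset by blast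
  have "left_engel G (u \<otimes> v)" if "left_engel G v" for v
    using assms that unfolding hirsch_plotkin_def
  proof (induction u arbitrary: v rule: generate.induct)
    case one
    moreover from one have "v \<in> carrier G" by (simp add: left_engel_def)
    ultimately show ?case by simp
  next
    case (incl h)
    then obtain N where "N \<lhd> G" "locally_nilpotent (G\<lparr>carrier := N\<rparr>)" "h \<in> N"
      by blast
    then show ?case using incl.prems by (intro left_engel_mult)
  next
    case (inv h)
    then obtain N where N: "N \<lhd> G" "locally_nilpotent (G\<lparr>carrier := N\<rparr>)" "h \<in> N"
      by blast
    then have "inv h \<in> N" by (intro subgroup.m_inv_closed[OF normal_imp_subgroup])
    then show ?case by (rule left_engel_mult[OF N(1,2) inv.prems])
  next
    case (eng h1 h2)
    have "left_engel G (h1 \<otimes> (h2 \<otimes> v))" by (rule eng.IH(1)[OF eng.IH(2)[OF eng.prems]])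
    moreover have "h1 \<in> carrier G" "h2 \<in> carrier G"
      by (rule generate_in_carrier[OF U], rule eng.hyps)+
    moreover have "v \<in> carrier G" using eng.prems by (simp add: left_engel_def)
    ultimately show ?case by (simp add: m_assoc)
  qed
  moreover have "left_engel G \<one>"
    unfolding left_engel_def
  proof (intro conjI ballI exI)
    \<comment> \<open>Index 0 would return \<open>a\<close> itself.\<close>
    show "engel G (Suc 0) a \<one> = \<one>" if "a \<in> carrier G" for a using that by simp
  qed simp
  ultimately have "left_engel G (u \<otimes> \<one>)" by blast
  moreover have "u \<in> carrier G"
    using assms generate_in_carrier[OF U] by (simp add: hirsch_plotkin_def)
  ultimately show ?thesis by simp
qed

lemma engel_radical_above:
  assumes H: "H \<lhd> G" and u: "u \<in> radical_above G H" and a: "a \<in> carrier G"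
  obtains n where "n \<ge> 1" "engel G n a u \<in> H"
proof -
  interpret H: normal H G by (rule H)
  interpret Q: group "G Mod H" by (rule H.factorgroup_is_group)
  interpret q: group_hom G "G Mod H" "\<lambda>x. H #> x"
    by (intro group_hom.intro group_hom_axioms.intro Q.is_group H.r_coset_hom_Mod is_group)
  have uc: "u \<in> carrier G" and "left_engel (G Mod H) (H #> u)"
    using u Q.left_engel_hirsch_plotkin by (auto simp: radical_above_def)
  then obtain n where "engel (G Mod H) n (H #> a) (H #> u) = \<one>\<^bsub>G Mod H\<^esub>"
    using q.hom_closed[OF a] unfolding left_engel_def by blast
  then have "H #> engel G n a u = H" unfolding q.hom_engel[OF a uc] by simp
  then have "engel G n a u \<in> H"
    using coset_join1[OF _ _ H.subgroup_axioms] a uc by simp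
  \<comment> \<open>One further commutator stays in the normal subgroup and makes the index
    positive, as compatible sequences demand.\<close>
  then have "engel G (Suc n) a u \<in> H" using H.commutator_in uc by simp
  then show ?thesis using that[of "Suc n"] by simp
qed

end

section \<open>Unbounded quasi-nil elements\<close>

lemma eps_Suc_shift:
  "eps G n x y (Suc k) = eps G (\<lambda>i. n (Suc i)) (\<lambda>i. x (Suc i)) (engel G (n 1) (x 1) y) k"
  by (induction k) auto

lemma map_upt_1_Suc: "map a [1..<Suc (Suc i)] = a 1 # map (\<lambda>i. a (Suc i)) [1..<Suc i]"
  by (simp add: upt_conv_Cons map_Suc_upt[symmetric] comp_def del: upt_Suc)

lemma (in group) unbounded_quasi_nil_one: "unbounded_quasi_nil G \<one>"
  unfolding unbounded_quasi_nil_def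
proof (intro conjI exI[of _ "\<lambda>_. 1"] allI impI exI[of _ "Suc 0"])
  fix a :: "nat \<Rightarrow> 'a" assume "\<forall>i\<ge>1. a i \<in> carrier G"
  then have "a 1 \<in> carrier G" by blast
  then show "eps G (\<lambda>i. 1) a \<one> (Suc 0) = \<one>" by simp
qed auto

text \<open>Read the functions \<open>N\<close> as a strategy answering the sequence term by term:
  answer the first term \<open>a\<close> by \<open>f a\<close>, then follow a strategy for
  \<open>engel G (f a) a g\<close> on the remaining terms. That strategy is chosen from
  \<open>a\<close> alone, so compatibility is kept.\<close>

lemma unbounded_quasi_nil_step:
  assumes g: "g \<in> carrier G"
    and step: "\<And>a. a \<in> carrier G \<Longrightarrow> \<exists>n\<ge>1. unbounded_quasi_nil G (engel G n a g)"
  shows "unbounded_quasi_nil G g"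
proof -
  obtain f where f: "\<And>a. a \<in> carrier G \<Longrightarrow> f a \<ge> 1 \<and> unbounded_quasi_nil G (engel G (f a) a g)"
    using step by metis
  then have "\<forall>a\<in>carrier G. \<exists>N :: 'a list \<Rightarrow> nat.
      (\<forall>as. as \<noteq> [] \<and> set as \<subseteq> carrier G \<longrightarrow> N as \<ge> 1) \<and>
      (\<forall>x. (\<forall>i\<ge>1. x i \<in> carrier G) \<longrightarrow>
        (\<exists>k\<ge>1. eps G (\<lambda>i. N (map x [1..<Suc i])) x (engel G (f a) a g) k = \<one>\<^bsub>G\<^esub>))"
    by (simp add: unbounded_quasi_nil_def)
  then obtain M :: "'a \<Rightarrow> 'a list \<Rightarrow> nat" where
    M1: "\<And>a as. a \<in> carrier G \<Longrightarrow> as \<noteq> [] \<Longrightarrow> set as \<subseteq> carrier G \<Longrightarrow> M a as \<ge> 1"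
    and M2: "\<And>a x. a \<in> carrier G \<Longrightarrow> (\<And>i. i \<ge> 1 \<Longrightarrow> x i \<in> carrier G) \<Longrightarrow>
      \<exists>k\<ge>1. eps G (\<lambda>i. M a (map x [1..<Suc i])) x (engel G (f a) a g) k = \<one>\<^bsub>G\<^esub>"
    by metis
  \<comment> \<open>A list of length 1 is the first move; on a longer list the head selects the
    strategy and the tail is its input.\<close>
  define N where "N as = (if tl as = [] then f (hd as) else M (hd as) (tl as))" for as
  show ?thesis
    unfolding unbounded_quasi_nil_def
  proof (intro conjI exI[of _ N] allI impI g)
    fix as assume "as \<noteq> [] \<and> set as \<subseteq> carrier G"
    then show "N as \<ge> 1" using f M1 by (cases as) (auto simp: N_def)
  next
    fix x :: "nat \<Rightarrow> 'a" assume x: "\<forall>i\<ge>1. x i \<in> carrier G"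
    define x' where "x' i = x (Suc i)" for i
    obtain k where k: "k \<ge> 1"
      "eps G (\<lambda>i. M (x 1) (map x' [1..<Suc i])) x' (engel G (f (x 1)) (x 1) g) k = \<one>\<^bsub>G\<^esub>"
      using M2[of "x 1" x'] x by (auto simp: x'_def)
    have N1: "N (map x [1..<Suc 1]) = f (x 1)" by (simp add: N_def)
    have NS: "N (map x [1..<Suc (Suc i)]) = M (x 1) (map x' [1..<Suc i])" if "i \<ge> 1" for i
      using that unfolding map_upt_1_Suc x'_def by (simp add: N_def)
    \<comment> \<open>The two index functions are matched only for positive arguments, the only ones
      that \<open>eps\<close> reads; hence an induction on \<open>j\<close> instead of
      extensionality.\<close>
    have eq: "eps G (\<lambda>i. N (map x [1..<Suc (Suc i)])) x' y j =
        eps G (\<lambda>i. M (x 1) (map x' [1..<Suc i])) x' y j" for y j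
    proof (induction j)
      case (Suc j)
      then show ?case using NS[of "Suc j"] by (simp del: upt_Suc)
    qed simp
    have "eps G (\<lambda>i. N (map x [1..<Suc i])) x g (Suc k) =
        eps G (\<lambda>i. N (map x [1..<Suc (Suc i)])) x' (engel G (f (x 1)) (x 1) g) k"
      unfolding eps_Suc_shift N1 x'_def ..
    then have "eps G (\<lambda>i. N (map x [1..<Suc i])) x g (Suc k) = \<one>\<^bsub>G\<^esub>"
      using k eq by simp
    then show "\<exists>k\<ge>1. eps G (\<lambda>i. N (map x [1..<Suc i])) x g k = \<one>\<^bsub>G\<^esub>"
      by (intro exI[of _ "Suc k"]) simp
  qed
qed

text \<open>Transfinite induction: at a successor, each \<open>a\<close> takes \<open>g\<close> into
  the preceding term, so one more move suffices; at a limit, \<open>g\<close> already lies in an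
  earlier term.\<close>

lemma unbounded_quasi_nil_upper_radical_series:
  assumes G: "group G" and r: "Well_order r"
  shows "g \<in> upper_radical_series G r \<alpha> \<Longrightarrow> unbounded_quasi_nil G g"
proof (induction \<alpha> arbitrary: g rule: wo_rel.well_order_induct[OF wo_rel.intro[OF r]])
  case (1 \<alpha>)
  note prems = "1.prems"
  let ?R = "upper_radical_series G r"
  have IH: "unbounded_quasi_nil G u" if "\<beta> \<in> underS r \<alpha>" "u \<in> ?R \<beta>" for \<beta> u
    using "1.IH" that by (auto simp: underS_def)
  consider "underS r \<alpha> = {}" | \<beta> where "underS r \<alpha> \<noteq> {}" "underS r \<alpha> = under r \<beta>"
    | "underS r \<alpha> \<noteq> {}" "\<nexists>\<beta>. underS r \<alpha> = under r \<beta>" by blast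
  then show ?case
  proof cases
    case 1
    then show ?thesis
      using prems upper_radical_series_zero[OF r 1, of G] group.unbounded_quasi_nil_one[OF G]
      by simp
  next
    case (2 \<beta>)
    have b: "\<beta> \<in> underS r \<alpha>" using succ_in_underS[OF r] 2 by blast
    have N: "?R \<beta> \<lhd> G" using upper_radical_series_ascending[OF G r] by blast
    have g: "g \<in> radical_above G (?R \<beta>)"
      using prems upper_radical_series_succ[OF r 2(2,1), of G] by simp
    show ?thesis
    proof (rule unbounded_quasi_nil_step)
      show "g \<in> carrier G" using g by (simp add: radical_above_def)
      show "\<exists>n\<ge>1. unbounded_quasi_nil G (engel G n a g)" if "a \<in> carrier G" for a
        using group.engel_radical_above[OF G N g that] IH[OF b] by metis
    qed
  next
    case 3
    then show ?thesis
      using prems upper_radical_series_limit[OF r 3, of G] IH by auto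
  qed
qed

theorem theorem5:
  fixes G :: "('a, 'b) monoid_scheme" and g :: 'a
  assumes "group G"
    and "g \<in> upper_radical G"
  shows "unbounded_quasi_nil G g"
proof -
  have "Well_order (cardSuc (card_of (carrier G)))"
    using cardSuc_Card_order[OF card_of_Card_order, of "carrier G"]
    unfolding card_order_on_def by (rule conjunct1)
  moreover obtain \<alpha> where
    "g \<in> upper_radical_series G (cardSuc (card_of (carrier G))) \<alpha>"
    using upper_radical_terminal(1)[OF assms(1)] assms(2) by auto
  ultimately show ?thesis
    by (rule unbounded_quasi_nil_upper_radical_series[OF assms(1)])
qed

end
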